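(* Let $q$ be a power of an odd prime and let $m,d$ be positive integers with $q-1=md$ and $d$ even. Let $H_0$ be the subgroup of $\mathbb{F}_q^{\ast}$ of order $m$, and let $u,v$ be two different elements of $H_0$, of multiplicative orders $m_0$ and $m_1$ respectively; write $n_0=m/m_0$ and $n_1=m/m_1$. Put $a=(v-u)/2$, $b=(u+v)/2$ and $f(x)=ax^{(q+1)/2}+bx\in\mathbb{F}_q[x]$. Then: (i) $f$ is a permutation polynomial of $\mathbb{F}_q$; (ii) the permutation induced by $f$ has cycle type $1+m_0^{dn_0/2}+m_1^{dn_1/2}$; (iii) the inverse permutation is induced by the binomial $a'x^{(q+1)/2}+b'x$, where $a'=(v^{-1}-u^{-1})/2$ and $b'=(u^{-1}+v^{-1})/2$.
   Context: The order of a nonzero element of $\mathbb{F}_q$ means its order in $\mathbb{F}_q^{\ast}$. A cycle type written $1+m_0^{k_0}+m_1^{k_1}$ means the permutation has exactly one fixed point and otherwise consists of $k_0$ disjoint cycles of length $m_0$ and $k_1$ disjoint cycles of length $m_1$ (if $m_0=m_1$ these counts add).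
   Formalization: The cycle type is read as a multiset of cycle lengths: if u=1 or v=1 (so m_0=1 or m_1=1), the extra cycles of length 1 add to the fixed point 0, since "exactly one fixed point" fails in that case. *)

theory Defs
  imports
    "HOL-Algebra.Algebraic_Closure_Type"
    "HOL-Combinatorics.Orbits"
    "HOL-Library.Cardinality"
    "HOL-Library.Multiset"
begin

abbreviation unit_group :: "'a :: field monoid" where
  "unit_group \<equiv> Multiplicative_Group.mult_of ring_of_type_algebra"

definition permutation_polynomial :: "'a :: {finite, field} poly \<Rightarrow> bool" where
  "permutation_polynomial p \<longleftrightarrow> bij (poly p)"

text \<open>
  The multiset of cycle lengths, fixed points included as cycles of length 1. It is meant for
  bijective arguments, whose orbits partition the type; \<open>range (orbit \<pi>)\<close> is then the set of
  cycles, each occurring once.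
\<close>
definition cycle_type :: "('a :: finite \<Rightarrow> 'a) \<Rightarrow> nat multiset" where
  "cycle_type \<pi> = image_mset card (mset_set (range (orbit \<pi>)))"

end

theory Submission
  imports Defs
begin

text \<open>
  For nonzero \<open>x\<close> the power \<open>x ^ ((q - 1) div 2)\<close> is \<open>1\<close> or \<open>- 1\<close>, and each value is attained
  \<open>(q - 1) div 2\<close> times, since neither polynomial \<open>X ^ ((q - 1) div 2) \<mp> 1\<close> has more roots than its
  degree. Hence \<open>f\<close> multiplies the first class by \<open>v\<close> and the second by \<open>u\<close>. As \<open>d\<close> is even, \<open>u\<close> and
  \<open>v\<close> belong to the first class, so both classes are preserved. On them the cycles are the cosets
  of the groups generated by \<open>v\<close> and \<open>u\<close>, and replacing \<open>u\<close>, \<open>v\<close> by their inverses inverts \<open>f\<close>.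
\<close>

section \<open>The multiplicative group of a field in terms of ordinary powers\<close>

lemma group_unit_group: "group (unit_group :: 'a :: Fields.field monoid)"
  by (rule field.field_mult_group) (rule field_from_type_algebra)

lemma carrier_unit_group: "carrier (unit_group :: 'a :: Fields.field monoid) = UNIV - {0}"
  by (simp add: carrier_mult_of ring_of_type_algebra_def)

lemma one_unit_group: "\<one>\<^bsub>unit_group\<^esub> = (1 :: 'a :: Fields.field)"
  by (simp add: ring_of_type_algebra_def)

lemma mult_unit_group: "x \<otimes>\<^bsub>unit_group\<^esub> y = (x * y :: 'a :: Fields.field)"
  by (simp add: ring_of_type_algebra_def)

lemma nat_pow_unit_group: "x [^]\<^bsub>unit_group\<^esub> (n :: nat) = (x ^ n :: 'a :: Fields.field)"
proof -
  interpret group "unit_group :: 'a monoid"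
    by (rule group_unit_group)
  show ?thesis
    by (induction n) (simp_all only: nat_pow_0 nat_pow_Suc one_unit_group mult_unit_group
        power_0 power_Suc2)
qed

text \<open>All later arguments use the order of an element only through this criterion;
  \<open>x \<noteq> 0\<close> is membership in the carrier.\<close>

lemma power_eq_1_iff_ord_dvd:
  fixes x :: "'a :: Fields.field"
  assumes "x \<noteq> 0"
  shows "x ^ n = 1 \<longleftrightarrow> group.ord unit_group x dvd n"
  using group.pow_eq_id[OF group_unit_group, of x n] assms
  by (simp only: nat_pow_unit_group one_unit_group carrier_unit_group) blast

lemma subgroup_power_card_eq_1:
  fixes x :: "'a :: Fields.field"
  assumes "subgroup H unit_group" and "x \<in> H"
  shows "x ^ card H = 1"
proof -
  interpret H: group "unit_group\<lparr>carrier := H\<rparr>"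
    by (rule subgroup.subgroup_is_group[OF assms(1) group_unit_group])
  have "x [^]\<^bsub>unit_group\<lparr>carrier := H\<rparr>\<^esub> card H = \<one>\<^bsub>unit_group\<^esub>"
    using H.pow_order_eq_1[of x] assms(2) by (simp add: Coset.order_def)
  \<comment> \<open>The power is built from the product and the unit alone, so shrinking the carrier
    to \<open>H\<close> does not change it.\<close>
  then have "x [^]\<^bsub>unit_group\<^esub> card H = \<one>\<^bsub>unit_group\<^esub>"
    by (simp add: nat_pow_def)
  then show ?thesis
    by (simp only: nat_pow_unit_group one_unit_group)
qed

lemma finite_field_power_card_minus_1:
  fixes x :: "'a :: {finite, field}"
  assumes "x \<noteq> 0"
  shows "x ^ (CARD('a) - 1) = 1"
proof -
  have "subgroup (UNIV - {0}) (unit_group :: 'a monoid)"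
    using group.subgroup_self[OF group_unit_group] by (simp only: carrier_unit_group)
  from subgroup_power_card_eq_1[OF this, of x] assms show ?thesis
    by (simp add: card_Diff_singleton)
qed

section \<open>The two half-power classes\<close>

lemma card_power_eq_le:
  fixes c :: "'a :: Fields.field"
  assumes "n > 0"
  shows "card {x. x ^ n = c} \<le> n"
proof -
  let ?p = "Polynomial.monom 1 n + [:- c:]"
  have deg: "Polynomial.degree ?p = n"
    using assms degree_add_eq_left[of "[:- c:]" "Polynomial.monom 1 n"]
    by (simp add: Polynomial.degree_monom_eq)
  then have "?p \<noteq> 0"
    using assms by force
  from card_poly_roots_bound[OF this] deg show ?thesis
    by (simp add: poly_monom)
qed

lemma half_power_cases:
  fixes x :: "'a :: {finite, field}"
  assumes "CARD('a) - 1 = 2 * h" and "x \<noteq> 0"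
  shows "x ^ h = 1 \<or> x ^ h = - 1"
proof -
  have "(x ^ h)\<^sup>2 = 1"
    using finite_field_power_card_minus_1[OF assms(2)] assms(1)
    by (simp add: power_mult[symmetric] mult.commute)
  then show ?thesis
    by (simp add: power2_eq_1_iff)
qed

text \<open>The classes have at most \<open>h\<close> elements each and together exhaust the
  \<open>2 * h\<close> nonzero elements, so both bounds are attained. If \<open>2 = 0\<close>, they
  would coincide and be too small.\<close>

lemma card_half_power_classes:
  assumes card: "CARD('a :: {finite, field}) - 1 = 2 * h" and "h > 0"
  shows "(2 :: 'a) \<noteq> 0"
    and "card {x :: 'a. x ^ h = 1} = h" and "card {x :: 'a. x ^ h = - 1} = h"
proof -
  let ?S = "{x :: 'a. x ^ h = 1}" and ?N = "{x :: 'a. x ^ h = - 1}"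
  have un: "?S \<union> ?N = UNIV - {0}"
    using half_power_cases[OF card] \<open>h > 0\<close> by (auto simp: zero_power)
  then have sum: "card (?S \<union> ?N) = 2 * h"
    using card by (simp add: card_Diff_singleton)
  have le: "card ?S \<le> h" "card ?N \<le> h"
    using card_power_eq_le \<open>h > 0\<close> by blast+
  show "(2 :: 'a) \<noteq> 0"
  proof
    assume "(2 :: 'a) = 0"
    then have "(- 1 :: 'a) = 1"
      by (metis add_eq_0_iff one_add_one)
    then have "?S = ?N"
      by (simp only:)
    with sum le \<open>h > 0\<close> show False
      by simp
  qed
  show "card ?S = h" "card ?N = h"
    using sum le card_Un_le[of ?S ?N] by linarith+
qed

text \<open>The coefficients have sum \<open>v\<close>, and the second minus the first is
  \<open>u\<close>. With \<open>u\<close> and \<open>v\<close> arbitrary, this also covers the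
  binomial built from the inverses.\<close>

lemma poly_binomial_half_power:
  fixes x u v :: "'a :: Fields.field" and h :: nat
  assumes "(2 :: 'a) \<noteq> 0"
  defines "g \<equiv> Polynomial.monom ((v - u) / 2) (Suc h) + Polynomial.monom ((u + v) / 2) 1"
  shows "x ^ h = 1 \<Longrightarrow> poly g x = v * x" and "x ^ h = - 1 \<Longrightarrow> poly g x = u * x"
    and "poly g 0 = 0"
proof -
  have "(v - u) / 2 + (u + v) / 2 = 2 * v / 2"
    by (simp only: add_divide_distrib[symmetric]) simp
  then have sum: "(v - u) / 2 + (u + v) / 2 = v"
    using assms(1) by simp
  have "(u + v) / 2 - (v - u) / 2 = 2 * u / 2"
    by (simp only: diff_divide_distrib[symmetric]) simp
  then have diff: "(u + v) / 2 - (v - u) / 2 = u"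
    using assms(1) by simp
  have poly_g: "poly g x = ((v - u) / 2 * x ^ h + (u + v) / 2) * x" for x
    by (simp add: g_def poly_monom distrib_right mult.assoc mult.commute[of x])
  show "x ^ h = 1 \<Longrightarrow> poly g x = v * x"
    by (simp add: poly_g sum)
  show "x ^ h = - 1 \<Longrightarrow> poly g x = u * x"
    using diff by (simp add: poly_g)
  show "poly g 0 = 0"
    by (simp add: poly_g)
qed

section \<open>Orbits and cycle lengths\<close>

lemma orbit_mult:
  fixes x w :: "'a :: Fields.field"
  assumes eq: "\<And>y. y \<in> S \<Longrightarrow> \<pi> y = w * y" and closed: "\<And>y. y \<in> S \<Longrightarrow> w * y \<in> S"
    and ord: "\<And>n. w ^ n = 1 \<longleftrightarrow> c dvd n" and "c > 0" and "x \<in> S" and "x \<noteq> 0"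
  shows "x \<in> orbit \<pi> x" and "orbit \<pi> x \<subseteq> S" and "card (orbit \<pi> x) = c"
proof -
  have iter: "(\<pi> ^^ n) x = w ^ n * x \<and> w ^ n * x \<in> S" for n
    using \<open>x \<in> S\<close> by (induction n) (auto simp: eq closed mult.assoc)
  \<comment> \<open>\<open>orbit\<close> collects only positive iterates; the return to
    \<open>x\<close> after \<open>c\<close> steps makes it equal to the iterates with exponent below
    \<open>c\<close>, zero included.\<close>
  have "(\<pi> ^^ c) x = x"
    using iter[of c] ord[of c] by simp
  then have orb: "orbit \<pi> x = (\<lambda>n. w ^ n * x) ` {..<c}"
    using orbit_altdef_bounded[of c \<pi> x] \<open>c > 0\<close> by (auto simp: iter)
  show "x \<in> orbit \<pi> x"
    unfolding orb using \<open>c > 0\<close> by (auto intro!: image_eqI[of _ _ 0])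
  show "orbit \<pi> x \<subseteq> S"
    unfolding orb using iter by auto
  have "w \<noteq> 0"
    using ord[of c] \<open>c > 0\<close> by (auto simp: zero_power)
  have le: "i = j" if "i \<le> j" "j < c" "w ^ i = w ^ j" for i j
  proof -
    have "w ^ i * w ^ (j - i) = w ^ i * 1"
      using that by (metis le_add_diff_inverse mult.right_neutral power_add)
    then have "c dvd j - i"
      using \<open>w \<noteq> 0\<close> ord by simp
    then show ?thesis
      using that by (auto dest: dvd_imp_le)
  qed
  have "inj_on (\<lambda>n. w ^ n * x) {..<c}"
  proof (rule inj_onI)
    fix i j
    assume "i \<in> {..<c}" "j \<in> {..<c}" "w ^ i * x = w ^ j * x"
    then show "i = j"
      using le[of i j] le[of j i] \<open>x \<noteq> 0\<close> by (cases "i \<le> j") auto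
  qed
  then show "card (orbit \<pi> x) = c"
    unfolding orb by (simp add: card_image)
qed

text \<open>Orbits containing their starting points are equal or disjoint, so they split
  \<open>S\<close> into blocks of size \<open>c\<close>.\<close>

lemma cycle_lengths_of_uniform_orbits:
  assumes "finite S" and "c > 0"
    and self: "\<And>x. x \<in> S \<Longrightarrow> x \<in> orbit \<pi> x" and sub: "\<And>x. x \<in> S \<Longrightarrow> orbit \<pi> x \<subseteq> S"
    and card: "\<And>x. x \<in> S \<Longrightarrow> card (orbit \<pi> x) = c"
  shows "image_mset card (mset_set (orbit \<pi> ` S)) = replicate_mset (card S div c) c"
proof -
  have un: "\<Union> (orbit \<pi> ` S) = S"
    using self sub by blast
  have orbit_eq: "orbit \<pi> y = orbit \<pi> x" if "x \<in> S" "y \<in> orbit \<pi> x" for x y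
    using cyclic_on_singleI[OF self[OF that(1)] refl] that(2) by (auto simp: cyclic_on_alldef)
  have "c * card (orbit \<pi> ` S) = card (\<Union> (orbit \<pi> ` S))"
  proof (rule card_partition)
    fix A B
    assume "A \<in> orbit \<pi> ` S" "B \<in> orbit \<pi> ` S" "A \<noteq> B"
    then show "A \<inter> B = {}"
      using orbit_eq by blast
  qed (use assms(1) un card in auto)
  then have "card (orbit \<pi> ` S) = card S div c"
    using un \<open>c > 0\<close> by (metis nonzero_mult_div_cancel_left not_less0)
  moreover have "image_mset card (mset_set (orbit \<pi> ` S)) = image_mset (\<lambda>_. c) (mset_set (orbit \<pi> ` S))"
    using assms(1) card by (intro image_mset_cong) auto
  ultimately show ?thesis
    by (simp add: image_mset_const_eq)
qed

text \<open>A nonempty orbit inside \<open>A\<close> differs from every orbit inside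
  \<open>B\<close>, so no cycle is counted twice.\<close>

lemma image_mset_orbits_Un:
  fixes A B :: "'a :: finite set"
  assumes "A \<inter> B = {}" and A: "\<And>x. x \<in> A \<Longrightarrow> orbit \<pi> x \<subseteq> A" and B: "\<And>x. x \<in> B \<Longrightarrow> orbit \<pi> x \<subseteq> B"
  shows "image_mset card (mset_set (orbit \<pi> ` (A \<union> B))) =
    image_mset card (mset_set (orbit \<pi> ` A)) + image_mset card (mset_set (orbit \<pi> ` B))"
proof -
  have "orbit \<pi> x \<noteq> orbit \<pi> y" if "x \<in> A" "y \<in> B" for x y
    using A[OF that(1)] B[OF that(2)] assms(1) orbit_nonempty[of \<pi> x] by blast
  then have "orbit \<pi> ` A \<inter> orbit \<pi> ` B = {}"
    by blast
  then show ?thesis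
    by (simp add: image_Un mset_set_Union)
qed

theorem mainTheorem2:
  fixes p k q m d m0 m1 n0 n1 :: nat
    and H0 :: "'a :: {finite, field} set"
    and u v a b a' b' :: 'a
    and f :: "'a poly"
  assumes "Factorial_Ring.prime p" and "odd p" and "k > 0" and "q = p ^ k"
    and "CARD('a) = q"
    and "m > 0" and "d > 0" and "q - 1 = m * d" and "even d"
    and "subgroup H0 unit_group" and "card H0 = m"
    and "u \<in> H0" and "v \<in> H0" and "u \<noteq> v"
    and "m0 = group.ord unit_group u" and "m1 = group.ord unit_group v"
    and "n0 = m div m0" and "n1 = m div m1"
    and "a = (v - u) / 2" and "b = (u + v) / 2"
    and "f = Polynomial.monom a ((q + 1) div 2) + Polynomial.monom b 1"
    and "a' = (inverse v - inverse u) / 2" and "b' = (inverse u + inverse v) / 2"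
  shows "permutation_polynomial f \<and>
    cycle_type (poly f) =
      {#1#} + replicate_mset (d * n0 div 2) m0 + replicate_mset (d * n1 div 2) m1 \<and>
    inv_into UNIV (poly f) = poly (Polynomial.monom a' ((q + 1) div 2) + Polynomial.monom b' 1)"
proof -
  obtain e where e: "d = 2 * e"
    using \<open>even d\<close> by blast
  \<comment> \<open>This is \<open>(q - 1) div 2\<close>, written as a multiple of \<open>m\<close>
    so that \<open>u ^ m = 1\<close> gives \<open>u ^ h = 1\<close>, and likewise for
    \<open>v\<close>.\<close>
  define h where "h = m * e"
  have "h > 0"
    using \<open>m > 0\<close> \<open>d > 0\<close> e by (simp add: h_def)
  have card: "CARD('a) - 1 = 2 * h"
    using assms(5,8) e by (simp add: h_def)
  then have exponent: "(q + 1) div 2 = Suc h"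
    using \<open>h > 0\<close> assms(5) by linarith
  note classes = card_half_power_classes[OF card \<open>h > 0\<close>]
  note two = classes(1)
  let ?S = "{x :: 'a. x ^ h = 1}" and ?N = "{x :: 'a. x ^ h = - 1}"
  have minus_one: "(- 1 :: 'a) \<noteq> 1"
    using two by (metis add.left_inverse one_add_one)
  have nonzero: "u \<noteq> 0" "v \<noteq> 0"
    using subgroup.subset[OF assms(10)] assms(12,13) unfolding carrier_unit_group by blast+
  have pow_m: "u ^ m = 1" "v ^ m = 1"
    using subgroup_power_card_eq_1[OF assms(10)] assms(11-13) by auto
  then have pow_h: "u ^ h = 1" "v ^ h = 1"
    by (simp_all add: h_def power_mult)
  have ord: "\<And>n. u ^ n = 1 \<longleftrightarrow> m0 dvd n" "\<And>n. v ^ n = 1 \<longleftrightarrow> m1 dvd n"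
    using power_eq_1_iff_ord_dvd nonzero assms(15,16) by auto
  then have dvd_m: "m0 dvd m" "m1 dvd m"
    using pow_m by auto
  \<comment> \<open>An order of \<open>0\<close> would mean infinite order; it cannot divide the
    positive \<open>m\<close>.\<close>
  then have pos: "m0 > 0" "m1 > 0"
    using \<open>m > 0\<close> by (auto intro: Nat.gr0I)
  let ?g = "Polynomial.monom a' ((q + 1) div 2) + Polynomial.monom b' 1"
  have f: "\<And>x. x \<in> ?S \<Longrightarrow> poly f x = v * x" "\<And>x. x \<in> ?N \<Longrightarrow> poly f x = u * x" "poly f 0 = 0"
    using poly_binomial_half_power[OF two] unfolding assms(19-21) exponent by blast+
  have g: "\<And>x. x \<in> ?S \<Longrightarrow> poly ?g x = inverse v * x" "\<And>x. x \<in> ?N \<Longrightarrow> poly ?g x = inverse u * x"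
    "poly ?g 0 = 0"
    using poly_binomial_half_power[OF two] unfolding assms(22,23) exponent by blast+
  \<comment> \<open>Multiplying by an element whose \<open>h\<close>-th power is \<open>1\<close>
    leaves \<open>x ^ h\<close> unchanged.\<close>
  have closed: "\<And>x. x \<in> ?S \<Longrightarrow> v * x \<in> ?S" "\<And>x. x \<in> ?N \<Longrightarrow> u * x \<in> ?N"
    "\<And>x. x \<in> ?S \<Longrightarrow> inverse v * x \<in> ?S" "\<And>x. x \<in> ?N \<Longrightarrow> inverse u * x \<in> ?N"
    using pow_h by (simp_all add: power_mult_distrib power_inverse)
  have cases: "x = 0 \<or> x \<in> ?S \<or> x \<in> ?N" for x
    using half_power_cases[OF card] by auto
  \<comment> \<open>As \<open>poly f x\<close> stays in the class of \<open>x\<close>,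
    \<open>?g\<close> multiplies it by the inverse of the very factor that \<open>f\<close>
    used.\<close>
  have gf: "poly ?g (poly f x) = x" for x
    using cases[of x]
  proof (elim disjE)
    assume "x \<in> ?S"
    then show ?thesis
      using g(1)[OF closed(1)] nonzero by (simp only: f(1)) simp
  next
    assume "x \<in> ?N"
    then show ?thesis
      using g(2)[OF closed(2)] nonzero by (simp only: f(2)) simp
  qed (simp only: f g)
  have fg: "poly f (poly ?g x) = x" for x
    using cases[of x]
  proof (elim disjE)
    assume "x \<in> ?S"
    then show ?thesis
      using f(1)[OF closed(3)] nonzero by (simp only: g(1)) simp
  next
    assume "x \<in> ?N"
    then show ?thesis
      using f(2)[OF closed(4)] nonzero by (simp only: g(2)) simp
  qed (simp only: f g)
  have perm: "permutation_polynomial f"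
    unfolding permutation_polynomial_def by (rule bij_betw_byWitness[of _ "poly ?g"]) (use fg gf in auto)
  have inverse: "inv_into UNIV (poly f) = poly ?g"
    by (rule inv_equality[OF gf fg])
  have not0: "0 \<notin> ?S" "0 \<notin> ?N"
    using \<open>h > 0\<close> by (auto simp: zero_power)
  have orbS: "x \<in> orbit (poly f) x" "orbit (poly f) x \<subseteq> ?S" "card (orbit (poly f) x) = m1"
    if "x \<in> ?S" for x
    using orbit_mult[of ?S "poly f" v m1 x] f(1) closed(1) ord(2) pos(2) that not0(1) by metis+
  have orbN: "x \<in> orbit (poly f) x" "orbit (poly f) x \<subseteq> ?N" "card (orbit (poly f) x) = m0"
    if "x \<in> ?N" for x
    using orbit_mult[of ?N "poly f" u m0 x] f(2) closed(2) ord(1) pos(1) that not0(2) by metis+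
  have orb0: "orbit (poly f) 0 = {0}"
    using orbit_altdef_bounded[of 1 "poly f" 0] f(3) by simp
  \<comment> \<open>\<open>?N\<close> precedes \<open>?S\<close> because its cycles have length
    \<open>m0\<close>, which comes first in the cycle type.\<close>
  have univ: "UNIV = {0} \<union> (?N \<union> ?S)"
    using cases by auto
  have "cycle_type (poly f) = image_mset card (mset_set (orbit (poly f) ` ({0} \<union> (?N \<union> ?S))))"
    unfolding cycle_type_def univ[symmetric] ..
  also have "\<dots> = image_mset card (mset_set (orbit (poly f) ` {0})) +
      image_mset card (mset_set (orbit (poly f) ` (?N \<union> ?S)))"
  proof (rule image_mset_orbits_Un)
    show "orbit (poly f) x \<subseteq> ?N \<union> ?S" if "x \<in> ?N \<union> ?S" for x
      using that orbN(2) orbS(2) by blast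
  qed (use not0 orb0 in auto)
  also have "image_mset card (mset_set (orbit (poly f) ` (?N \<union> ?S))) =
      image_mset card (mset_set (orbit (poly f) ` ?N)) + image_mset card (mset_set (orbit (poly f) ` ?S))"
    by (rule image_mset_orbits_Un) (use minus_one orbN(2) orbS(2) in auto)
  also have "image_mset card (mset_set (orbit (poly f) ` ?N)) = replicate_mset (h div m0) m0"
    using cycle_lengths_of_uniform_orbits[OF _ pos(1) orbN] by (simp add: classes(3))
  also have "image_mset card (mset_set (orbit (poly f) ` ?S)) = replicate_mset (h div m1) m1"
    using cycle_lengths_of_uniform_orbits[OF _ pos(2) orbS] by (simp add: classes(2))
  \<comment> \<open>Since \<open>m0\<close> divides \<open>m\<close>, the quotient of
    \<open>h = m * e\<close> is \<open>n0 * e\<close>, and \<open>e\<close> is half of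
    \<open>d\<close>.\<close>
  also have "h div m0 = d * n0 div 2"
    using dvd_m(1) by (simp add: h_def e assms(17) div_mult_swap mult.commute)
  also have "h div m1 = d * n1 div 2"
    using dvd_m(2) by (simp add: h_def e assms(18) div_mult_swap mult.commute)
  finally have "cycle_type (poly f) =
      {#1#} + replicate_mset (d * n0 div 2) m0 + replicate_mset (d * n1 div 2) m1"
    by (simp add: orb0)
  with perm inverse show ?thesis
    by blast
qed

end
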